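(* Let $(A,\blacktriangleright,\blacktriangleleft,\alpha)$ be a Hom-M-dendriform algebra. Then the product $x\cdot y=x\blacktriangleleft y+x\blacktriangleright y$ defines a Hom-pre-Malcev algebra $(A,\cdot,\alpha)$, and the product $x\diamond y=x\blacktriangleleft y-y\blacktriangleright x$ defines a Hom-pre-Malcev algebra $(A,\diamond,\alpha)$.
   Context: All vector spaces are over a field $\mathbb{K}$ of characteristic $0$. A Hom-pre-Malcev algebra is a triple $(A,\cdot,\alpha)$ consisting of a vector space $A$, a bilinear product $\cdot:A\times A\to A$ and a linear map $\alpha:A\to A$ such that for all $x,y,z,t\in A$, with $[x,y]=x\cdot y-y\cdot x$, $$\alpha([y,z])\cdot\alpha(x\cdot t)+[[x,y],\alpha(z)]\cdot\alpha^2(t)+\alpha^2(y)\cdot([x,z]\cdot\alpha(t))-\alpha^2(x)\cdot(\alpha(y)\cdot(z\cdot t))+\alpha^2(z)\cdot(\alpha(x)\cdot(y\cdot t))=0.$$ A Hom-M-dendriform algebra $(A,\blacktriangleright,\blacktriangleleft,\alpha)$ is a vector space $A$ with two bilinear products $\blacktriangleright,\blacktriangleleft:A\times A\to A$ and a linear map $\alpha:A\to A$ such that, writing $x\cdot y=x\blacktriangleleft y+x\blacktriangleright y$, $x\diamond y=x\blacktriangleleft y-y\blacktriangleright x$, $[x,y]=x\cdot y-y\cdot x=x\diamond y-y\diamond x$, for all $x,y,z,t\in A$: $$(\alpha(z)\diamond(y\diamond x))\blacktriangleright\alpha^2(t)-\alpha^2(x)\blacktriangleright(\alpha(y)\cdot(z\cdot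 t))+\alpha^2(z)\blacktriangleleft(\alpha(x)\blacktriangleright(y\cdot t))+\alpha([y,z])\blacktriangleleft\alpha(x\blacktriangleright t)-\alpha^2(y)\blacktriangleleft((z\diamond x)\blacktriangleright\alpha(t))=0,$$ $$\alpha^2(z)\blacktriangleleft(\alpha(x)\blacktriangleleft(y\blacktriangleright t))-(\alpha(z)\diamond(x\diamond y))\blacktriangleright\alpha^2(t)-\alpha^2(x)\blacktriangleleft(\alpha(y)\blacktriangleright(z\cdot t))-\alpha(z\diamond y)\blacktriangleright\alpha(x\cdot t)+\alpha^2(y)\blacktriangleright([x,z]\cdot\alpha(t))=0,$$ $$\alpha^2(z)\blacktriangleright(\alpha(x)\cdot(y\cdot t))+([x,y]\diamond\alpha(z))\blacktriangleright\alpha^2(t)-\alpha^2(x)\blacktriangleleft(\alpha(y)\blacktriangleleft(z\blacktriangleright t))+\alpha(y\diamond z)\blacktriangleright\alpha(x\cdot t)+\alpha^2(y)\blacktriangleleft((x\diamond z)\blacktriangleright\alpha(t))=0,$$ $$[[x,y],\alpha(z)]\blacktriangleleft\alpha^2(t)-\alpha^2(x)\blacktriangleleft(\alpha(y)\blacktriangleleft(z\blacktriangleleft t))+\alpha^2(z)\blacktriangleleft(\alpha(x)\blacktriangleleft(y\blacktriangleleft t))+\alpha([y,z])\blacktriangleleft\alpha(x\blacktriangleleft t)+\alpha^2(y)\blacktriangleleft([x,z]\blacktriangleleft\alpha(t))=0.$$ *)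

theory Defs
  imports Complex_Main
begin

text \<open>
  The library's \<open>bilinear\<close> is restricted to real vector spaces; this is its analogue over
  an arbitrary scalar multiplication. The predicate \<open>Vector_Spaces.linear scale scale\<close>
  includes that \<open>scale\<close> makes the type a vector space.
\<close>

definition bilinear_over :: "('k::field \<Rightarrow> 'a::ab_group_add \<Rightarrow> 'a) \<Rightarrow> ('a \<Rightarrow> 'a \<Rightarrow> 'a) \<Rightarrow> bool" where
  "bilinear_over scale f \<longleftrightarrow>
     (\<forall>x. Vector_Spaces.linear scale scale (\<lambda>y. f x y)) \<and>
     (\<forall>y. Vector_Spaces.linear scale scale (\<lambda>x. f x y))"

text \<open>
  The twisting map \<open>\<alpha>\<close> is only required to be linear: it need not respect the products.
  The square of \<open>\<alpha>\<close> is written as \<open>\<alpha> (\<alpha> x)\<close>.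
\<close>

locale hom_pre_malcev_data = vector_space scale
  for scale :: "'k::field_char_0 \<Rightarrow> 'a::ab_group_add \<Rightarrow> 'a" +
  fixes dot :: "'a \<Rightarrow> 'a \<Rightarrow> 'a" (infixl "\<cdot>" 70)
    and \<alpha> :: "'a \<Rightarrow> 'a"
  assumes bilinear_dot: "bilinear_over scale (\<cdot>)"
    and linear_twist: "Vector_Spaces.linear scale scale \<alpha>"
begin

abbreviation bracket :: "'a \<Rightarrow> 'a \<Rightarrow> 'a" ("\<lblot>_, _\<rblot>") where
  "\<lblot>x, y\<rblot> \<equiv> x \<cdot> y - y \<cdot> x"

end

locale hom_pre_malcev = hom_pre_malcev_data +
  assumes hom_pre_malcev_identity:
    "\<alpha> \<lblot>y, z\<rblot> \<cdot> \<alpha> (x \<cdot> t) + \<lblot>\<lblot>x, y\<rblot>, \<alpha> z\<rblot> \<cdot> \<alpha> (\<alpha> t)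
     + \<alpha> (\<alpha> y) \<cdot> (\<lblot>x, z\<rblot> \<cdot> \<alpha> t) - \<alpha> (\<alpha> x) \<cdot> (\<alpha> y \<cdot> (z \<cdot> t))
     + \<alpha> (\<alpha> z) \<cdot> (\<alpha> x \<cdot> (y \<cdot> t)) = 0"

locale hom_M_dendriform_data = vector_space scale
  for scale :: "'k::field_char_0 \<Rightarrow> 'a::ab_group_add \<Rightarrow> 'a" +
  fixes rprod :: "'a \<Rightarrow> 'a \<Rightarrow> 'a" (infixl "\<triangleright>" 70)
    and lprod :: "'a \<Rightarrow> 'a \<Rightarrow> 'a" (infixl "\<triangleleft>" 70)
    and \<alpha> :: "'a \<Rightarrow> 'a"
  assumes bilinear_rprod: "bilinear_over scale (\<triangleright>)"
    and bilinear_lprod: "bilinear_over scale (\<triangleleft>)"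
    and linear_twist: "Vector_Spaces.linear scale scale \<alpha>"
begin

abbreviation dot :: "'a \<Rightarrow> 'a \<Rightarrow> 'a" (infixl "\<cdot>" 70) where
  "x \<cdot> y \<equiv> x \<triangleleft> y + x \<triangleright> y"

abbreviation diamond :: "'a \<Rightarrow> 'a \<Rightarrow> 'a" (infixl "\<diamondop>" 70) where
  "x \<diamondop> y \<equiv> x \<triangleleft> y - y \<triangleright> x"

text \<open>The bracket of \<open>\<cdot>\<close>, which is also the bracket of \<open>\<diamondop>\<close>.\<close>

abbreviation bracket :: "'a \<Rightarrow> 'a \<Rightarrow> 'a" ("\<lblot>_, _\<rblot>") where
  "\<lblot>x, y\<rblot> \<equiv> x \<cdot> y - y \<cdot> x"

lemma bracket_eq_diamond: "\<lblot>x, y\<rblot> = x \<diamondop> y - y \<diamondop> x"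
  by (simp add: algebra_simps)

end

locale hom_M_dendriform = hom_M_dendriform_data +
  assumes hom_M_dendriform_1:
    "(\<alpha> z \<diamondop> (y \<diamondop> x)) \<triangleright> \<alpha> (\<alpha> t) - \<alpha> (\<alpha> x) \<triangleright> (\<alpha> y \<cdot> (z \<cdot> t))
     + \<alpha> (\<alpha> z) \<triangleleft> (\<alpha> x \<triangleright> (y \<cdot> t)) + \<alpha> \<lblot>y, z\<rblot> \<triangleleft> \<alpha> (x \<triangleright> t)
     - \<alpha> (\<alpha> y) \<triangleleft> ((z \<diamondop> x) \<triangleright> \<alpha> t) = 0"
  and hom_M_dendriform_2:
    "\<alpha> (\<alpha> z) \<triangleleft> (\<alpha> x \<triangleleft> (y \<triangleright> t)) - (\<alpha> z \<diamondop> (x \<diamondop> y)) \<triangleright> \<alpha> (\<alpha> t)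
     - \<alpha> (\<alpha> x) \<triangleleft> (\<alpha> y \<triangleright> (z \<cdot> t)) - \<alpha> (z \<diamondop> y) \<triangleright> \<alpha> (x \<cdot> t)
     + \<alpha> (\<alpha> y) \<triangleright> (\<lblot>x, z\<rblot> \<cdot> \<alpha> t) = 0"
  and hom_M_dendriform_3:
    "\<alpha> (\<alpha> z) \<triangleright> (\<alpha> x \<cdot> (y \<cdot> t)) + (\<lblot>x, y\<rblot> \<diamondop> \<alpha> z) \<triangleright> \<alpha> (\<alpha> t)
     - \<alpha> (\<alpha> x) \<triangleleft> (\<alpha> y \<triangleleft> (z \<triangleright> t)) + \<alpha> (y \<diamondop> z) \<triangleright> \<alpha> (x \<cdot> t)
     + \<alpha> (\<alpha> y) \<triangleleft> ((x \<diamondop> z) \<triangleright> \<alpha> t) = 0"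
  and hom_M_dendriform_4:
    "\<lblot>\<lblot>x, y\<rblot>, \<alpha> z\<rblot> \<triangleleft> \<alpha> (\<alpha> t) - \<alpha> (\<alpha> x) \<triangleleft> (\<alpha> y \<triangleleft> (z \<triangleleft> t))
     + \<alpha> (\<alpha> z) \<triangleleft> (\<alpha> x \<triangleleft> (y \<triangleleft> t)) + \<alpha> \<lblot>y, z\<rblot> \<triangleleft> \<alpha> (x \<triangleleft> t)
     + \<alpha> (\<alpha> y) \<triangleleft> (\<lblot>x, z\<rblot> \<triangleleft> \<alpha> t) = 0"

end

theory Submission
  imports Defs
begin

text \<open>
  Each of the four axioms of a Hom-M-dendriform algebra is a marked version of the
  Hom-pre-Malcev identity. Mark one of the variables \<open>x, y, z, t\<close>, and in every product
  \<open>u \<cdot> v\<close> with the marked variable inside one factor, replace the product by \<open>u \<triangleright> v\<close> if that factor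
  is \<open>u\<close> and by \<open>u \<triangleleft> v\<close> if it is \<open>v\<close>; a product without the marked variable stays as it is.
  A commutator \<open>[u, v]\<close> thereby becomes \<open>u \<diamondop> v\<close> if the mark is in \<open>v\<close>, and \<open>- (v \<diamondop> u)\<close> if it is
  in \<open>u\<close>. Marking \<open>x\<close>, \<open>y\<close>, \<open>z\<close> and \<open>t\<close> in the Hom-pre-Malcev identity gives the first, second,
  third and fourth axiom.

  For \<open>\<cdot>\<close>, one fixes the assignment of arguments and lets the mark vary: since \<open>u \<cdot> v\<close> is the sum of
  its two marked versions, the four axioms at \<open>(x, y, z, t)\<close> add up to the Hom-pre-Malcev identity.

  For \<open>\<diamondop>\<close>, one fixes the marked argument and lets it move through the four slots. The unmarked
  background is that a Hom-pre-Malcev identity, summed over the cyclic group of argument orders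
  \<open>(x, y, z, t)\<close>, \<open>(y, t, x, z)\<close>, \<open>(t, z, y, x)\<close>, \<open>(z, x, t, y)\<close>, turns into an identity in
  commutators alone (the Hom-Malcev identity):
  \<open>[\<alpha>[y, z], \<alpha>[x, t]] + [[[x, y], \<alpha> z], \<alpha>\<^sup>2 t] + [\<alpha>\<^sup>2 y, [[x, z], \<alpha> t]]
    - [\<alpha>\<^sup>2 x, [\<alpha> y, [z, t]]] + [\<alpha>\<^sup>2 z, [\<alpha> x, [y, t]]] = 0\<close>.
  Marking \<open>t\<close> turns every commutator around \<open>t\<close> into a product \<open>\<diamondop>\<close>, and the result is the
  Hom-pre-Malcev identity for \<open>\<diamondop>\<close>, because \<open>\<cdot>\<close> and \<open>\<diamondop>\<close> have the same commutator.
  On the other side, \<open>t\<close> occupies the fourth, second, first and third slot in the orders listed, so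
  the marked summands are the fourth, second, first and third axiom.
\<close>

context vector_space
begin

lemma bilinear_over_add:
  assumes "bilinear_over scale f" and "bilinear_over scale g"
  shows "bilinear_over scale (\<lambda>x y. f x y + g x y)"
proof -
  interpret vector_space_pair scale scale
    by unfold_locales
  show ?thesis
    using assms by (auto simp: bilinear_over_def intro: linear_compose_add)
qed

lemma bilinear_over_diff:
  assumes "bilinear_over scale f" and "bilinear_over scale g"
  shows "bilinear_over scale (\<lambda>x y. f x y - g x y)"
proof -
  interpret vector_space_pair scale scale
    by unfold_locales
  show ?thesis
    using assms by (auto simp: bilinear_over_def intro: linear_compose_sub)
qed

end

lemma bilinear_over_flip:
  "bilinear_over scale f \<Longrightarrow> bilinear_over scale (\<lambda>x y. f y x)"
  by (simp add: bilinear_over_def)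

lemma bilinear_over_additive:
  assumes "bilinear_over scale f"
  shows "f (x + y) z = f x z + f y z" "f z (x + y) = f z x + f z y"
    and "f (x - y) z = f x z - f y z" "f z (x - y) = f z x - f z y"
proof -
  interpret left: Vector_Spaces.linear scale scale "\<lambda>x. f x z"
    using assms by (simp add: bilinear_over_def)
  interpret right: Vector_Spaces.linear scale scale "f z"
    using assms by (simp add: bilinear_over_def)
  show "f (x + y) z = f x z + f y z" "f z (x + y) = f z x + f z y"
    by (fact left.add right.add)+
  show "f (x - y) z = f x z - f y z" "f z (x - y) = f z x - f z y"
    by (fact left.diff right.diff)+
qed

context hom_M_dendriform
begin

lemmas rprod_additive = bilinear_over_additive[OF bilinear_rprod]
lemmas lprod_additive = bilinear_over_additive[OF bilinear_lprod]

lemma twist_additive: "\<alpha> (x + y) = \<alpha> x + \<alpha> y" "\<alpha> (x - y) = \<alpha> x - \<alpha> y"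
proof -
  interpret twist: Vector_Spaces.linear scale scale \<alpha>
    by (fact linear_twist)
  show "\<alpha> (x + y) = \<alpha> x + \<alpha> y" "\<alpha> (x - y) = \<alpha> x - \<alpha> y"
    by (fact twist.add twist.diff)+
qed

text \<open>
  Every monomial is the sum of its four marked versions, so this identity is the sum of the
  four axioms at the same arguments.
\<close>

lemma dot_identity:
  "\<alpha> \<lblot>y, z\<rblot> \<cdot> \<alpha> (x \<cdot> t) + \<lblot>\<lblot>x, y\<rblot>, \<alpha> z\<rblot> \<cdot> \<alpha> (\<alpha> t)
   + \<alpha> (\<alpha> y) \<cdot> (\<lblot>x, z\<rblot> \<cdot> \<alpha> t) - \<alpha> (\<alpha> x) \<cdot> (\<alpha> y \<cdot> (z \<cdot> t))
   + \<alpha> (\<alpha> z) \<cdot> (\<alpha> x \<cdot> (y \<cdot> t)) = 0" (is "?P = 0")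
proof -
  note axioms_sum =
    arg_cong2[where f = "(+)", OF
      arg_cong2[where f = "(+)", OF hom_M_dendriform_1[of z y x t] hom_M_dendriform_2[of z x y t]]
      arg_cong2[where f = "(+)", OF hom_M_dendriform_3[of z x y t] hom_M_dendriform_4[of x y z t]]]
  have "?P = 0 + 0 + (0 + 0)"
    unfolding axioms_sum[symmetric]
    by (simp only: rprod_additive lprod_additive twist_additive) (simp add: algebra_simps)
  then show ?thesis
    by simp
qed

text \<open>
  This identity is the Hom-Malcev identity of the commutator with \<open>t\<close> marked. It is the sum of the
  axioms with \<open>t\<close> in the marked slot, taken over the cyclic group of argument orders. In that sum
  the terms with \<open>\<alpha> (\<alpha> t)\<close> as left factor combine to \<open>- \<alpha> (\<alpha> t) \<triangleright> \<lblot>\<lblot>x, y\<rblot>, \<alpha> z\<rblot>\<close>.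
\<close>

lemma diamond_identity:
  "\<alpha> \<lblot>y, z\<rblot> \<diamondop> \<alpha> (x \<diamondop> t) + \<lblot>\<lblot>x, y\<rblot>, \<alpha> z\<rblot> \<diamondop> \<alpha> (\<alpha> t)
   + \<alpha> (\<alpha> y) \<diamondop> (\<lblot>x, z\<rblot> \<diamondop> \<alpha> t) - \<alpha> (\<alpha> x) \<diamondop> (\<alpha> y \<diamondop> (z \<diamondop> t))
   + \<alpha> (\<alpha> z) \<diamondop> (\<alpha> x \<diamondop> (y \<diamondop> t)) = 0" (is "?P = 0")
proof -
  \<comment> \<open>The argument orders are \<open>(t, z, y, x)\<close>, \<open>(y, t, x, z)\<close>, \<open>(z, x, t, y)\<close> and \<open>(x, y, z, t)\<close>;
    the facts list their variables by first occurrence.\<close>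
  note axioms_sum =
    arg_cong2[where f = "(+)", OF
      arg_cong2[where f = "(+)", OF hom_M_dendriform_1[of y z t x] hom_M_dendriform_2[of x y t z]]
      arg_cong2[where f = "(+)", OF hom_M_dendriform_3[of t z x y] hom_M_dendriform_4[of x y z t]]]
  have "?P = 0 + 0 + (0 + 0)"
    unfolding axioms_sum[symmetric]
    by (simp only: rprod_additive lprod_additive twist_additive) (simp add: algebra_simps)
  then show ?thesis
    by simp
qed

lemma hom_pre_malcev_dot: "hom_pre_malcev scale (\<cdot>) \<alpha>"
  by (intro hom_pre_malcev.intro hom_pre_malcev_data.intro hom_pre_malcev_data_axioms.intro
      hom_pre_malcev_axioms.intro vector_space_axioms linear_twist dot_identity
      bilinear_over_add bilinear_lprod bilinear_rprod)

lemma hom_pre_malcev_diamond: "hom_pre_malcev scale (\<diamondop>) \<alpha>"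
  by (intro hom_pre_malcev.intro hom_pre_malcev_data.intro hom_pre_malcev_data_axioms.intro
      hom_pre_malcev_axioms.intro vector_space_axioms linear_twist
      diamond_identity[unfolded bracket_eq_diamond]
      bilinear_over_diff bilinear_lprod bilinear_over_flip[OF bilinear_rprod])

end

theorem theorem4p1:
  fixes scale :: "'k::field_char_0 \<Rightarrow> 'a::ab_group_add \<Rightarrow> 'a"
    and rprod :: "'a \<Rightarrow> 'a \<Rightarrow> 'a" (infixl "\<triangleright>" 70)
    and lprod :: "'a \<Rightarrow> 'a \<Rightarrow> 'a" (infixl "\<triangleleft>" 70)
    and \<alpha> :: "'a \<Rightarrow> 'a"
  assumes "hom_M_dendriform scale (\<triangleright>) (\<triangleleft>) \<alpha>"
  shows "hom_pre_malcev scale (\<lambda>x y. x \<triangleleft> y + x \<triangleright> y) \<alpha> \<and>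
         hom_pre_malcev scale (\<lambda>x y. x \<triangleleft> y - y \<triangleright> x) \<alpha>"
  using hom_M_dendriform.hom_pre_malcev_dot[OF assms]
    hom_M_dendriform.hom_pre_malcev_diamond[OF assms] by blast

end
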